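(* Every analytic set of reals satisfies $\mathsf{T}$, i.e., none of its Borel images in $[\mathbb{N}]^\infty$ is a tower. In particular, the Baire space $\mathbb{N}^\mathbb{N}$ belongs to $\mathsf{T}$.
   Context: An analytic set is a continuous image of a Borel set. $[\mathbb{N}]^\infty$ is the space of infinite subsets of $\mathbb{N}$ (subspace of $P(\mathbb{N})\cong\{0,1\}^\mathbb{N}$). $a\subseteq^* b$ means $a\setminus b$ is finite. A pseudo-intersection of $Y\subseteq[\mathbb{N}]^\infty$ is an infinite $a\subseteq\mathbb{N}$ with $a\subseteq^*b$ for all $b\in Y$. A tower is a family $Y\subseteq[\mathbb{N}]^\infty$ linearly quasiordered by $\subseteq^*$ having no pseudo-intersection. A Borel image of $X$ in $Z$ is $f[X]$ for a Borel function $f:X\to Z$. $\mathsf{T}$ is the class of sets $X$ (sets of reals, or separable zero-dimensional metric spaces such as $\mathbb{N}^\mathbb{N}$) such that no Borel image of $X$ in $[\mathbb{N}]^\infty$ is a tower. *)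

theory Defs
  imports "HOL-Analysis.Analysis"
begin

text \<open>
  The power set carries the topology of \<open>{0,1}\<close>-sequences: it is identified with
  \<^typ>\<open>'a \<Rightarrow> bool\<close> under the product topology (\<^typ>\<open>bool\<close> being discrete), via
  characteristic functions.
\<close>

instantiation set :: (type) topological_space
begin

definition open_set :: "'a set set \<Rightarrow> bool"
  where "open_set U \<longleftrightarrow> (\<exists>V :: ('a \<Rightarrow> bool) set. open V \<and> U = (\<lambda>a n. n \<in> a) -` V)"

instance
proof
  show "open (UNIV :: 'a set set)"
    unfolding open_set_def by (rule exI[of _ UNIV]) simp
next
  fix S T :: "'a set set"
  assume "open S" "open T"
  then obtain V W :: "('a \<Rightarrow> bool) set"
    where "open V" "S = (\<lambda>a n. n \<in> a) -` V" "open W" "T = (\<lambda>a n. n \<in> a) -` W"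
    unfolding open_set_def by blast
  then show "open (S \<inter> T)"
    unfolding open_set_def by (intro exI[of _ "V \<inter> W"]) auto
next
  fix K :: "'a set set set"
  assume "\<forall>S\<in>K. open S"
  then obtain V :: "'a set set \<Rightarrow> ('a \<Rightarrow> bool) set"
    where "\<forall>S\<in>K. open (V S) \<and> S = (\<lambda>a n. n \<in> a) -` V S"
    unfolding open_set_def by metis
  then show "open (\<Union>K)"
    unfolding open_set_def by (intro exI[of _ "\<Union>S\<in>K. V S"]) (auto simp: vimage_Union)
qed

end

definition infinite_subsets :: "nat set set"  (\<open>[\<nat>]\<^sup>\<infinity>\<close>)
  where "[\<nat>]\<^sup>\<infinity> = {a. infinite a}"

definition almost_subset :: "'a set \<Rightarrow> 'a set \<Rightarrow> bool"  (infix \<open>\<subseteq>\<^sup>*\<close> 50)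
  where "a \<subseteq>\<^sup>* b \<longleftrightarrow> finite (a - b)"

definition pseudo_intersection :: "nat set \<Rightarrow> nat set set \<Rightarrow> bool"
  where "pseudo_intersection a Y \<longleftrightarrow> infinite a \<and> (\<forall>b\<in>Y. a \<subseteq>\<^sup>* b)"

text \<open>
  Since \<open>\<subseteq>\<^sup>*\<close> is always reflexive and transitive, being linearly quasiordered by it amounts to
  comparability.
\<close>

definition tower :: "nat set set \<Rightarrow> bool"
  where "tower Y \<longleftrightarrow> Y \<subseteq> [\<nat>]\<^sup>\<infinity> \<and> (\<forall>a\<in>Y. \<forall>b\<in>Y. a \<subseteq>\<^sup>* b \<or> b \<subseteq>\<^sup>* a) \<and>
    \<not> (\<exists>a. pseudo_intersection a Y)"

text \<open>Both sets carry the Borel structure of their subspace topologies.\<close>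

definition borel_function ::
    "'a::topological_space set \<Rightarrow> 'b::topological_space set \<Rightarrow> ('a \<Rightarrow> 'b) \<Rightarrow> bool"
  where "borel_function X Z f \<longleftrightarrow> f \<in> restrict_space borel X \<rightarrow>\<^sub>M restrict_space borel Z"

definition borel_image ::
    "'a::topological_space set \<Rightarrow> 'b::topological_space set \<Rightarrow> 'b set \<Rightarrow> bool"
  where "borel_image X Z Y \<longleftrightarrow> (\<exists>f. borel_function X Z f \<and> Y = f ` X)"

definition class_T :: "'a::topological_space set set"  (\<open>\<T>\<close>)
  where "\<T> = {X. \<not> (\<exists>Y. borel_image X [\<nat>]\<^sup>\<infinity> Y \<and> tower Y)}"

text \<open>
  A set is analytic if it is a continuous image of a Borel subset of a Polish space. A definition
  cannot quantify over types, so the Polish space \<open>'b\<close> is an explicit parameter; results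
  are to be stated for an arbitrary \<open>'b\<close>. With \<^typ>\<open>real\<close> for \<open>'b\<close> these are the
  continuous images of Borel sets of reals.
\<close>

definition analytic_set :: "'b::polish_space itself \<Rightarrow> 'a::topological_space set \<Rightarrow> bool"
  where "analytic_set TYPE('b) A \<longleftrightarrow>
    (\<exists>(B :: 'b set) f. B \<in> sets borel \<and> continuous_on B f \<and> A = f ` B)"

end

theory Submission
  imports Defs
begin

text \<open>
  Inside a tower \<open>Y\<close>, the subsets having a pseudo-intersection form a \<open>\<sigma>\<close>-ideal; call the
  other subsets large. A Borel image of a Borel set is a continuous image \<open>e ` C\<close> of a closed
  subset of a complete separable metric space, because the graph of the Borel function is a
  projection of such a set. If \<open>e ` C\<close> were a tower, then any two closed pieces \<open>S\<close>, \<open>T\<close> of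
  \<open>C\<close> with large images could be shrunk to small closed pieces that still have large images,
  so that some arbitrarily large \<open>n\<close> belongs to every \<open>e x\<close> with \<open>x\<close> in the first piece
  and to no \<open>e y\<close> with \<open>y\<close> in the second: otherwise the infinitely many \<open>n\<close> that occur on
  a large part of \<open>S\<close> would form a pseudo-intersection of a large part of \<open>T\<close>. Alternating the
  roles of the two pieces and passing to the limit yields two \<open>\<subseteq>\<^sup>*\<close>-incomparable members of the
  tower.
\<close>

section \<open>Almost inclusion and the \<sigma>-ideal inside a tower\<close>

lemma almost_subset_refl: "a \<subseteq>\<^sup>* a"
  by (simp add: almost_subset_def)

lemma almost_subset_trans:
  assumes "a \<subseteq>\<^sup>* b" "b \<subseteq>\<^sup>* c"
  shows "a \<subseteq>\<^sup>* c"
proof -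
  have "a - c \<subseteq> (a - b) \<union> (b - c)" by blast
  then show ?thesis
    using assms unfolding almost_subset_def by (meson finite_UnI finite_subset)
qed

text \<open>Each finite intersection contains almost all of some \<open>y m\<close>, hence is
  infinite; choosing ever larger points from these intersections diagonalizes.\<close>

lemma countable_chain_pseudo_intersection:
  assumes inf: "\<And>n. infinite (y n)" and chain: "\<And>m n. y m \<subseteq>\<^sup>* y n \<or> y n \<subseteq>\<^sup>* y m"
  shows "\<exists>a. pseudo_intersection a (range (y :: nat \<Rightarrow> nat set))"
proof -
  have min: "\<exists>m. \<forall>i\<le>n. y m \<subseteq>\<^sup>* y i" for n
  proof (induction n)
    case 0
    show ?case by (auto simp: almost_subset_def intro!: exI[of _ 0])
  next
    case (Suc n)
    then obtain m where m: "\<forall>i\<le>n. y m \<subseteq>\<^sup>* y i" by blast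
    from chain[of m "Suc n"] show ?case
      using m almost_subset_trans almost_subset_refl by (metis le_Suc_eq)
  qed
  have inf': "infinite (\<Inter>i\<le>n. y i)" for n
  proof
    assume fin: "finite (\<Inter>i\<le>n. y i)"
    obtain m where m: "\<forall>i\<le>n. y m \<subseteq>\<^sup>* y i" using min by blast
    have "finite (\<Union>i\<le>n. y m - y i)"
      using m by (intro finite_UN_I) (auto simp: almost_subset_def)
    with fin have "finite ((\<Union>i\<le>n. y m - y i) \<union> (\<Inter>i\<le>n. y i))" by (rule finite_UnI[rotated])
    then have "finite (y m)" by (rule finite_subset[rotated]) blast
    then show False using inf by blast
  qed
  have "\<exists>p. \<forall>n. p n \<in> (\<Inter>i\<le>n. y i) \<and> p n < (p (Suc n) :: nat)"
    using inf' by (intro dependent_nat_choice) (fastforce simp: infinite_nat_iff_unbounded)+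
  then obtain p where p: "\<And>n i. i \<le> n \<Longrightarrow> p n \<in> y i" and less: "\<And>n. p n < p (Suc n)"
    by blast
  have "strict_mono p" using less by (rule strict_mono_Suc_iff[THEN iffD2, rule_format])
  then have "infinite (range p)"
    using finite_imageD strict_mono_imp_inj_on infinite_UNIV_nat by blast
  moreover have "range p \<subseteq>\<^sup>* y i" for i
  proof -
    have "range p - y i \<subseteq> p ` {..<i}"
    proof
      fix k assume "k \<in> range p - y i"
      then obtain n where n: "k = p n" "p n \<notin> y i" by blast
      then have "n < i" using p[of i n] by (meson not_le)
      then show "k \<in> p ` {..<i}" using n(1) by simp
    qed
    then show ?thesis unfolding almost_subset_def by (rule finite_subset) simp
  qed
  ultimately show ?thesis unfolding pseudo_intersection_def by blast
qed

text \<open>Each \<open>Z\<close> has a lower bound inside \<open>Y\<close>: otherwise every member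
  of \<open>Y\<close> would lie almost above a member of \<open>Z\<close>, and a pseudo-intersection
  of \<open>Z\<close> would be one of \<open>Y\<close>. These countably many bounds form a chain, so
  they have a pseudo-intersection themselves.\<close>

lemma tower_countable_union_pseudo_intersection:
  assumes "tower Y" and "countable \<Z>"
    and sub: "\<And>Z. Z \<in> \<Z> \<Longrightarrow> Z \<subseteq> Y" and pi: "\<And>Z. Z \<in> \<Z> \<Longrightarrow> \<exists>a. pseudo_intersection a Z"
  shows "\<exists>a. pseudo_intersection a (\<Union>\<Z>)"
proof (cases "\<Z> = {}")
  case True
  then show ?thesis using infinite_UNIV_nat by (auto simp: pseudo_intersection_def)
next
  case False
  have Y: "\<And>a. a \<in> Y \<Longrightarrow> infinite a" "\<And>a b. a \<in> Y \<Longrightarrow> b \<in> Y \<Longrightarrow> a \<subseteq>\<^sup>* b \<or> b \<subseteq>\<^sup>* a"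
    "\<And>a. \<not> pseudo_intersection a Y"
    using \<open>tower Y\<close> by (auto simp: tower_def infinite_subsets_def)
  have "\<exists>b\<in>Y. \<forall>z\<in>Z. b \<subseteq>\<^sup>* z" if Z: "Z \<in> \<Z>" for Z
  proof (rule ccontr)
    assume nb: "\<not> (\<exists>b\<in>Y. \<forall>z\<in>Z. b \<subseteq>\<^sup>* z)"
    obtain a where a: "pseudo_intersection a Z" using pi Z by blast
    have "a \<subseteq>\<^sup>* b" if b: "b \<in> Y" for b
    proof -
      obtain z where z: "z \<in> Z" "\<not> b \<subseteq>\<^sup>* z" using nb b by blast
      then have "z \<subseteq>\<^sup>* b" using Y(2) b sub Z by blast
      moreover have "a \<subseteq>\<^sup>* z" using a z by (simp add: pseudo_intersection_def)
      ultimately show ?thesis using almost_subset_trans by blast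
    qed
    then show False using a Y(3) by (auto simp: pseudo_intersection_def)
  qed
  then obtain b where b: "\<And>Z. Z \<in> \<Z> \<Longrightarrow> b Z \<in> Y" "\<And>Z z. Z \<in> \<Z> \<Longrightarrow> z \<in> Z \<Longrightarrow> b Z \<subseteq>\<^sup>* z"
    by metis
  define y where "y n = b (from_nat_into \<Z> n)" for n
  have yY: "y n \<in> Y" for n unfolding y_def using b(1) from_nat_into[OF False] by blast
  then obtain a where a: "pseudo_intersection a (range y)"
    using countable_chain_pseudo_intersection[of y] Y by blast
  have "a \<subseteq>\<^sup>* z" if Z: "Z \<in> \<Z>" "z \<in> Z" for Z z
  proof -
    obtain n where "from_nat_into \<Z> n = Z"
      using from_nat_into_surj[OF \<open>countable \<Z>\<close> Z(1)] by blast
    then have "y n \<subseteq>\<^sup>* z" unfolding y_def using b(2) Z by blast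
    moreover have "a \<subseteq>\<^sup>* y n" using a by (auto simp: pseudo_intersection_def)
    ultimately show ?thesis using almost_subset_trans by blast
  qed
  then show ?thesis using a by (auto simp: pseudo_intersection_def)
qed

section \<open>Large closed pieces and the construction of incomparable members\<close>

text \<open>
  The sort of \<open>'q\<close> is that of Polish spaces written out: the library does not make products
  of arbitrary \<^class>\<open>polish_space\<close> types an instance of that class.
\<close>

locale closed_tower_image =
  fixes C :: "'q::{complete_space, second_countable_topology} set" and e :: "'q \<Rightarrow> nat set"
  assumes closed: "closed C"
    and closed_mem: "\<And>n. closed {q \<in> C. n \<in> e q}"
    and closed_not_mem: "\<And>n. closed {q \<in> C. n \<notin> e q}"
    and tower: "tower (e ` C)"
begin

definition large :: "'q set \<Rightarrow> bool"
  where "large S \<longleftrightarrow> closed S \<and> S \<subseteq> C \<and> \<not> (\<exists>a. pseudo_intersection a (e ` S))"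

lemma large_nonempty: "large S \<Longrightarrow> S \<noteq> {}"
  using infinite_UNIV_nat unfolding large_def pseudo_intersection_def by blast

text \<open>This is the \<sigma>-ideal property read on the domain: were no piece large, each of
  their images would have a pseudo-intersection, and so would the image of \<open>S\<close>.\<close>

lemma large_countable_cover:
  assumes "large S" "countable \<F>" "S \<subseteq> \<Union>\<F>"
    and closedF: "\<And>F. F \<in> \<F> \<Longrightarrow> closed (S \<inter> F)"
  shows "\<exists>F\<in>\<F>. large (S \<inter> F)"
proof (rule ccontr)
  assume *: "\<not> (\<exists>F\<in>\<F>. large (S \<inter> F))"
  have "\<exists>a. pseudo_intersection a (\<Union>((\<lambda>F. e ` (S \<inter> F)) ` \<F>))"
    by (rule tower_countable_union_pseudo_intersection[OF tower])
      (use assms * in \<open>auto simp: large_def\<close>)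
  moreover have "(\<Union>((\<lambda>F. e ` (S \<inter> F)) ` \<F>)) = e ` S" using assms(3) by blast
  ultimately show False using assms(1) by (simp add: large_def)
qed

text \<open>Balls of radius \<open>\<epsilon>/3\<close> around a countable dense set form a
  countable cover. They are taken closed so that the pieces stay closed, and
  \<open>2*\<epsilon>/3\<close> is still strictly below \<open>\<epsilon>\<close>.\<close>

lemma large_small_diameter:
  assumes "large S" "\<epsilon> > 0"
  shows "\<exists>S'. large S' \<and> S' \<subseteq> S \<and> (\<forall>x\<in>S'. \<forall>y\<in>S'. dist x y < \<epsilon>)"
proof -
  obtain D :: "'q set"
    where D: "countable D \<and> (\<forall>X. open X \<longrightarrow> X \<noteq> {} \<longrightarrow> (\<exists>d\<in>D. d \<in> X))"
    using countable_dense_exists ..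
  have "S \<subseteq> \<Union>((\<lambda>d. cball d (\<epsilon>/3)) ` D)"
  proof
    fix x :: 'q
    have "open (ball x (\<epsilon>/3))" "ball x (\<epsilon>/3) \<noteq> {}" using assms(2) by simp_all
    then obtain d where "d \<in> D" "d \<in> ball x (\<epsilon>/3)" using D by blast
    then show "x \<in> \<Union>((\<lambda>d. cball d (\<epsilon>/3)) ` D)" by (force simp: dist_commute)
  qed
  then have "\<exists>F\<in>(\<lambda>d. cball d (\<epsilon>/3)) ` D. large (S \<inter> F)"
    using D assms(1) by (intro large_countable_cover[OF assms(1)]) (auto simp: large_def)
  then obtain d where "large (S \<inter> cball d (\<epsilon>/3))" by blast
  moreover have "dist x y < \<epsilon>" if "x \<in> cball d (\<epsilon>/3)" "y \<in> cball d (\<epsilon>/3)" for x y :: 'q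
    using that dist_triangle3[of x y d] assms(2) by simp
  ultimately show ?thesis by (intro exI[of _ "S \<inter> cball d (\<epsilon>/3)"]) auto
qed

lemma large_split:
  assumes "large S" "large T"
  shows "\<exists>n>m. large {q \<in> S. n \<in> e q} \<and> large {q \<in> T. n \<notin> e q}"
proof (rule ccontr)
  assume no: "\<not> (\<exists>n>m. large {q \<in> S. n \<in> e q} \<and> large {q \<in> T. n \<notin> e q})"
  txt \<open>\<open>A\<close> will be a pseudo-intersection of a large part of the image of \<open>T\<close>.\<close>
  define A where "A = {n. n > m \<and> large {q \<in> S. n \<in> e q}}"
  have ST: "closed S" "S \<subseteq> C" "closed T" "T \<subseteq> C" using assms by (auto simp: large_def)
  have S_int: "{q \<in> S. n \<in> e q} = S \<inter> {q \<in> C. n \<in> e q}" for n using ST by auto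
  have T_int: "{q \<in> T. n \<notin> e q} = T \<inter> {q \<in> C. n \<notin> e q}" for n using ST by auto
  \<comment> \<open>Every \<open>e q\<close> with \<open>q\<close> in \<open>S\<close> is infinite,
    so it has an element above \<open>m\<close> outside a finite \<open>A\<close>. Some such index
    would give a large piece of \<open>S\<close>, against the definition of
    \<open>A\<close>.\<close>
  have "infinite A"
  proof
    assume fin: "finite A"
    have "S \<subseteq> \<Union>((\<lambda>n. {q \<in> C. n \<in> e q}) ` {n. n > m \<and> n \<notin> A})"
    proof
      fix q assume q: "q \<in> S"
      then have "infinite (e q - ({..m} \<union> A))"
        using ST tower fin by (intro Diff_infinite_finite) (auto simp: tower_def infinite_subsets_def)
      then obtain n where "n \<in> e q - ({..m} \<union> A)" using infinite_imp_nonempty by blast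
      then show "q \<in> \<Union>((\<lambda>n. {q \<in> C. n \<in> e q}) ` {n. n > m \<and> n \<notin> A})"
        using q ST by (auto simp: not_le)
    qed
    then have "\<exists>F\<in>(\<lambda>n. {q \<in> C. n \<in> e q}) ` {n. n > m \<and> n \<notin> A}. large (S \<inter> F)"
      using ST closed_mem by (intro large_countable_cover[OF assms(1)]) auto
    then obtain n where "n > m" "n \<notin> A" "large (S \<inter> {q \<in> C. n \<in> e q})" by blast
    then show False by (simp add: A_def S_int)
  qed
  have A: "\<not> large (T \<inter> {q \<in> C. n \<notin> e q})" if "n \<in> A" for n
    using no that by (auto simp: A_def T_int)
  let ?R = "{q \<in> C. A \<subseteq> e q}"
  \<comment> \<open>By \<open>no\<close>, the part of \<open>T\<close> omitting a given
    \<open>n\<close> in \<open>A\<close> is never large, so in this countable cover only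
    \<open>?R\<close> can yield a large piece.\<close>
  let ?\<F> = "insert ?R ((\<lambda>n. {q \<in> C. n \<notin> e q}) ` A)"
  have "closed (C \<inter> (\<Inter>n\<in>A. {q \<in> C. n \<in> e q}))"
    by (intro closed_Int closed_INT ballI closed closed_mem)
  moreover have "C \<inter> (\<Inter>n\<in>A. {q \<in> C. n \<in> e q}) = ?R" by blast
  ultimately have "closed ?R" by (simp only:)
  then have "\<exists>F\<in>?\<F>. large (T \<inter> F)"
    using ST closed_not_mem
    by (intro large_countable_cover[OF assms(2)]) auto
  then have "large (T \<inter> ?R)" using A by blast
  moreover have "pseudo_intersection A (e ` (T \<inter> ?R))"
    using \<open>infinite A\<close> by (auto simp: pseudo_intersection_def almost_subset_def Diff_eq_empty_iff[THEN iffD2])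
  ultimately show False by (auto simp: large_def)
qed

text \<open>\<open>large_split\<close> is applied twice, the second time with the roles exchanged
  and to the pieces already obtained; shrinking preserves the first separation.\<close>

lemma large_refine:
  assumes "large S" "large T" "\<epsilon> > 0"
  obtains S' T' where "large S'" "large T'" "S' \<subseteq> S" "T' \<subseteq> T"
    "\<forall>x\<in>S'. \<forall>y\<in>S'. dist x y < \<epsilon>" "\<forall>x\<in>T'. \<forall>y\<in>T'. dist x y < \<epsilon>"
    "\<exists>n>m. \<forall>x\<in>S'. \<forall>y\<in>T'. n \<in> e x - e y" "\<exists>n>m. \<forall>x\<in>S'. \<forall>y\<in>T'. n \<in> e y - e x"
proof -
  obtain n where n: "n > m" and L: "large {q \<in> S. n \<in> e q}" "large {q \<in> T. n \<notin> e q}"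
    using large_split[OF assms(1,2)] by blast
  obtain k where k: "k > m" and L':
    "large {q \<in> {q \<in> T. n \<notin> e q}. k \<in> e q}" "large {q \<in> {q \<in> S. n \<in> e q}. k \<notin> e q}"
    using large_split[OF L(2,1)] by blast
  from large_small_diameter[OF L'(2) assms(3)] obtain S' where S': "large S'"
    "S' \<subseteq> {q \<in> {q \<in> S. n \<in> e q}. k \<notin> e q}" "\<forall>x\<in>S'. \<forall>y\<in>S'. dist x y < \<epsilon>" by blast
  from large_small_diameter[OF L'(1) assms(3)] obtain T' where T': "large T'"
    "T' \<subseteq> {q \<in> {q \<in> T. n \<notin> e q}. k \<in> e q}" "\<forall>x\<in>T'. \<forall>y\<in>T'. dist x y < \<epsilon>" by blast
  have "\<forall>x\<in>S'. \<forall>y\<in>T'. n \<in> e x - e y" "\<forall>x\<in>S'. \<forall>y\<in>T'. k \<in> e y - e x"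
    using S'(2) T'(2) by blast+
  moreover have "S' \<subseteq> S" "T' \<subseteq> T" using S'(2) T'(2) by blast+
  ultimately show thesis using n k S'(1,3) T'(1,3) by (intro that[of S' T']) (assumption | blast)+
qed

lemma contradiction: False
proof -
  let ?P = "\<lambda>(k::nat) (S, T). large S \<and> large T"
  let ?Q = "\<lambda>k (S, T) (S', T'). S' \<subseteq> S \<and> T' \<subseteq> T \<and>
    (\<forall>x\<in>S'. \<forall>y\<in>S'. dist x y < inverse (real (Suc k))) \<and>
    (\<forall>x\<in>T'. \<forall>y\<in>T'. dist x y < inverse (real (Suc k))) \<and>
    (\<exists>n>k. \<forall>x\<in>S'. \<forall>y\<in>T'. n \<in> e x - e y) \<and> (\<exists>n>k. \<forall>x\<in>S'. \<forall>y\<in>T'. n \<in> e y - e x)"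
  \<comment> \<open>The pair \<open>(C, C)\<close> can serve as the start: the two pieces need not
    be disjoint.\<close>
  have "large C" using closed tower by (auto simp: large_def tower_def)
  then have "\<exists>x. ?P 0 x" by auto
  moreover have "\<exists>y. ?P (Suc k) y \<and> ?Q k x y" if "?P k x" for x k
  proof -
    obtain S T where x: "x = (S, T)" by force
    have "large S" "large T" "0 < inverse (real (Suc k))" using that by (simp_all add: x)
    then obtain S' T' where "large S'" "large T'" "S' \<subseteq> S" "T' \<subseteq> T"
      "\<forall>x\<in>S'. \<forall>y\<in>S'. dist x y < inverse (real (Suc k))"
      "\<forall>x\<in>T'. \<forall>y\<in>T'. dist x y < inverse (real (Suc k))"
      "\<exists>n>k. \<forall>x\<in>S'. \<forall>y\<in>T'. n \<in> e x - e y" "\<exists>n>k. \<forall>x\<in>S'. \<forall>y\<in>T'. n \<in> e y - e x"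
      by (rule large_refine)
    then show ?thesis unfolding x by (intro exI[of _ "(S', T')"]) (simp only: prod.case simp_thms)
  qed
  ultimately have "\<exists>f. \<forall>k. ?P k (f k) \<and> ?Q k (f k) (f (Suc k))"
    by (rule dependent_nat_choice)
  then obtain f where f: "\<forall>k. ?P k (f k) \<and> ?Q k (f k) (f (Suc k))" ..
  define S where "S k = fst (f k)" for k
  define T where "T k = snd (f k)" for k
  have fk: "f k = (S k, T k)" for k by (simp add: S_def T_def)
  note f' = f[unfolded fk prod.case, rule_format]
  \<comment> \<open>Cantor's intersection theorem: in a complete space, nested nonempty closed sets
    of vanishing diameter share a point.\<close>
  have nest: "\<exists>q. \<forall>k. q \<in> U k"
    if L: "\<And>k. large (U k)" and sub: "\<And>k. U (Suc k) \<subseteq> U k"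
      and d: "\<And>k. \<forall>x\<in>U (Suc k). \<forall>y\<in>U (Suc k). dist x y < inverse (real (Suc k))" for U
  proof -
    have "\<exists>n. \<forall>x\<in>U n. \<forall>y\<in>U n. dist x y < \<epsilon>" if "\<epsilon> > 0" for \<epsilon>
      using reals_Archimedean[OF that] d by (meson less_trans)
    moreover have "U n \<subseteq> U m" if "m \<le> n" for m n
      using lift_Suc_antimono_le[of U] sub that by blast
    moreover have "closed (U k)" "U k \<noteq> {}" for k
      using L large_nonempty by (auto simp: large_def)
    ultimately show ?thesis using decreasing_closed_nest[of U] by metis
  qed
  obtain x where x: "\<And>k. x \<in> S k" using nest[of S] f' by blast
  obtain y where y: "\<And>k. y \<in> T k" using nest[of T] f' by blast
  \<comment> \<open>Stage \<open>k\<close> separates the pieces of index \<open>Suc k\<close> at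
    some \<open>n > k\<close>; letting \<open>k\<close> vary makes the difference unbounded.\<close>
  have "\<exists>n>k. n \<in> e x - e y" for k using f'[of k] x[of "Suc k"] y[of "Suc k"] by blast
  then have "\<not> e x \<subseteq>\<^sup>* e y" by (simp add: almost_subset_def infinite_nat_iff_unbounded)
  moreover have "\<exists>n>k. n \<in> e y - e x" for k using f'[of k] x[of "Suc k"] y[of "Suc k"] by blast
  then have "\<not> e y \<subseteq>\<^sup>* e x" by (simp add: almost_subset_def infinite_nat_iff_unbounded)
  moreover have "x \<in> C" "y \<in> C" using f'[of 0] x[of 0] y[of 0] by (auto simp: large_def)
  ultimately show False using tower unfolding tower_def by blast
qed

end

section \<open>Borel sets as projections of closed sets\<close>

text \<open>
  The witnesses range over \<^typ>\<open>nat \<Rightarrow> real\<close> instead of the Baire space since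
  \<^typ>\<open>nat\<close> carries no metric in the library.
\<close>

definition closed_projection :: "'a::topological_space set \<Rightarrow> bool"
  where "closed_projection B \<longleftrightarrow> 
    (\<exists>C :: ('a \<times> (nat \<Rightarrow> real)) set. closed C \<and> (\<forall>x. x \<in> B \<longleftrightarrow> (\<exists>z. (x, z) \<in> C)))"

lemma closed_projectionI:
  fixes C :: "('a::topological_space \<times> (nat \<Rightarrow> real)) set"
  assumes "closed C" "\<And>x. x \<in> B \<longleftrightarrow> (\<exists>z. (x, z) \<in> C)"
  shows "closed_projection B"
  unfolding closed_projection_def using assms by (intro exI[of _ C] conjI allI)

lemma closed_imp_closed_projection: "closed B \<Longrightarrow> closed_projection B"
  by (rule closed_projectionI[of "B \<times> UNIV"]) (simp_all add: closed_Times)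

lemma closed_projection_UN:
  fixes B :: "nat \<Rightarrow> 'a::topological_space set"
  assumes "\<And>n. closed_projection (B n)"
  shows "closed_projection (\<Union>n. B n)"
proof -
  have "\<forall>n. \<exists>C :: ('a \<times> (nat \<Rightarrow> real)) set. closed C \<and> (\<forall>x. x \<in> B n \<longleftrightarrow> (\<exists>z. (x, z) \<in> C))"
    using assms unfolding closed_projection_def by (rule allI)
  from choice[OF this] obtain C :: "nat \<Rightarrow> ('a \<times> (nat \<Rightarrow> real)) set"
    where "\<forall>n. closed (C n) \<and> (\<forall>x. x \<in> B n \<longleftrightarrow> (\<exists>z. (x, z) \<in> C n))" ..
  then have C: "\<And>n. closed (C n)" "\<And>n x. x \<in> B n \<longleftrightarrow> (\<exists>z. (x, z) \<in> C n)"
    by simp_all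
  let ?g = "\<lambda>p :: 'a \<times> (nat \<Rightarrow> real). (fst p, \<lambda>k. snd p (Suc k))"
  txt \<open>
    The coordinate \<open>z 0\<close> names the member of the union. Writing the disjoint union of the pieces as an
    intersection makes its closedness evident.
  \<close>
  let ?D = "{p. snd p 0 \<in> \<nat>} \<inter> (\<Inter>n. {p. 1/2 \<le> \<bar>snd p 0 - real n\<bar>} \<union> ?g -` C n)"
  have coord: "continuous_on UNIV (\<lambda>p :: 'a \<times> (nat \<Rightarrow> real). snd p k)" for k
    by (rule continuous_on_product_then_coordinatewise[OF continuous_on_snd[OF continuous_on_id]])
  have nat: "closed {p :: 'a \<times> (nat \<Rightarrow> real). snd p 0 \<in> \<nat>}"
    using closed_vimage[OF closed_Nats coord[of 0]] by (simp add: vimage_def)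
  have away: "closed {p :: 'a \<times> (nat \<Rightarrow> real). 1/2 \<le> \<bar>snd p 0 - real n\<bar>}" for n
    by (intro closed_Collect_le coord continuous_intros)
  have tail: "closed (?g -` C n)" for n
    by (intro closed_vimage C coord continuous_on_Pair continuous_on_fst continuous_on_id
        continuous_on_coordinatewise_then_product)
  have "closed ?D" by (intro closed_Int closed_INT closed_Un ballI nat away tail)
  then show ?thesis
  proof (rule closed_projectionI)
    fix x
    show "x \<in> (\<Union>n. B n) \<longleftrightarrow> (\<exists>z. (x, z) \<in> ?D)"
    proof
      assume "x \<in> (\<Union>n. B n)"
      then obtain n z where z: "(x, z) \<in> C n" using C by blast
      \<comment> \<open>Distinct naturals are at least 1 apart, so only the piece of index
        \<open>n\<close> constrains the tail of the witness.\<close>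
      have "1/2 \<le> \<bar>real n - real m\<bar>" if "m \<noteq> n" for m
        using that by linarith
      then have "(x, case_nat (real n) z) \<in> {p. 1/2 \<le> \<bar>snd p 0 - real m\<bar>} \<union> ?g -` C m" for m
        using z by (cases "m = n") simp_all
      then have "(x, case_nat (real n) z) \<in> ?D" by simp
      then show "\<exists>z. (x, z) \<in> ?D" by blast
    next
      assume "\<exists>z. (x, z) \<in> ?D"
      then obtain z where z: "(x, z) \<in> ?D" by blast
      then have "z 0 \<in> \<nat>" by simp
      then obtain n where n: "z 0 = real n" by (rule Nats_cases)
      have "(x, z) \<in> {p. 1/2 \<le> \<bar>snd p 0 - real n\<bar>} \<union> ?g -` C n" using z by blast
      then have "(x, \<lambda>k. z (Suc k)) \<in> C n" by (simp add: n)
      then show "x \<in> (\<Union>n. B n)" using C by blast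
    qed
  qed
qed

text \<open>One sequence stores a witness for every index: \<open>prod_encode\<close> splits it into
  rows, and row \<open>n\<close> is tested against \<open>C n\<close>.\<close>

lemma closed_projection_INT:
  fixes B :: "nat \<Rightarrow> 'a::topological_space set"
  assumes "\<And>n. closed_projection (B n)"
  shows "closed_projection (\<Inter>n. B n)"
proof -
  have "\<forall>n. \<exists>C :: ('a \<times> (nat \<Rightarrow> real)) set. closed C \<and> (\<forall>x. x \<in> B n \<longleftrightarrow> (\<exists>z. (x, z) \<in> C))"
    using assms unfolding closed_projection_def by (rule allI)
  from choice[OF this] obtain C :: "nat \<Rightarrow> ('a \<times> (nat \<Rightarrow> real)) set"
    where "\<forall>n. closed (C n) \<and> (\<forall>x. x \<in> B n \<longleftrightarrow> (\<exists>z. (x, z) \<in> C n))" ..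
  then have C: "\<And>n. closed (C n)" "\<And>n x. x \<in> B n \<longleftrightarrow> (\<exists>z. (x, z) \<in> C n)"
    by simp_all
  let ?g = "\<lambda>n (p :: 'a \<times> (nat \<Rightarrow> real)). (fst p, \<lambda>k. snd p (prod_encode (n, k)))"
  have coord: "continuous_on UNIV (\<lambda>p :: 'a \<times> (nat \<Rightarrow> real). snd p k)" for k
    by (rule continuous_on_product_then_coordinatewise[OF continuous_on_snd[OF continuous_on_id]])
  have "closed (\<Inter>n. ?g n -` C n)"
    by (intro closed_INT ballI closed_vimage C coord continuous_on_Pair continuous_on_fst
        continuous_on_id continuous_on_coordinatewise_then_product)
  then show ?thesis
  proof (rule closed_projectionI)
    fix x
    show "x \<in> (\<Inter>n. B n) \<longleftrightarrow> (\<exists>z. (x, z) \<in> (\<Inter>n. ?g n -` C n))"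
    proof
      assume "x \<in> (\<Inter>n. B n)"
      then have "\<forall>n. \<exists>z. (x, z) \<in> C n" using C by blast
      then obtain z where z: "\<And>n. (x, z n) \<in> C n" by metis
      then have "(x, \<lambda>i. case_prod z (prod_decode i)) \<in> (\<Inter>n. ?g n -` C n)" by simp
      then show "\<exists>z. (x, z) \<in> (\<Inter>n. ?g n -` C n)" by blast
    qed (use C in auto)
  qed
qed

text \<open>In a metric space an open set is a countable union of closed sets: \<open>?F n\<close>
  consists of the points at distance at least \<open>1/(n+1)\<close> from every point of the
  complement.\<close>

lemma open_imp_closed_projection:
  fixes U :: "'a::metric_space set"
  assumes "open U"
  shows "closed_projection U"
proof -
  let ?F = "\<lambda>n. - (\<Union>x\<in>-U. ball x (inverse (real (Suc n))))"
  have "U = (\<Union>n. ?F n)"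
  proof
    show "U \<subseteq> (\<Union>n. ?F n)"
    proof
      fix x assume "x \<in> U"
      then obtain \<epsilon> where \<epsilon>: "\<epsilon> > 0" "ball x \<epsilon> \<subseteq> U" using assms open_contains_ball by blast
      obtain n where "inverse (real (Suc n)) < \<epsilon>" using reals_Archimedean[OF \<epsilon>(1)] by blast
      then have "x \<in> ?F n" using \<epsilon>(2) by (force simp: dist_commute)
      then show "x \<in> (\<Union>n. ?F n)" by blast
    qed
    have "x \<in> U" if "x \<in> ?F n" for x n
    proof (rule ccontr)
      assume "x \<notin> U"
      then have "x \<in> (\<Union>y\<in>-U. ball y (inverse (real (Suc n))))"
        by (intro UN_I[of x]) simp_all
      with that show False by blast
    qed
    then show "(\<Union>n. ?F n) \<subseteq> U" by blast
  qed
  moreover have "closed_projection (?F n)" for n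
    by (intro closed_imp_closed_projection) auto
  ultimately show ?thesis using closed_projection_UN[of ?F] by simp
qed

text \<open>Complements do not pass through projections, so the induction carries \<open>B\<close>
  and \<open>- B\<close> together; complementation then turns unions into intersections.\<close>

lemma borel_imp_closed_projection:
  fixes B :: "'a::metric_space set"
  assumes "B \<in> sets borel"
  shows "closed_projection B"
proof -
  from assms have "B \<in> sigma_sets UNIV {S. open S}" by (simp add: borel_def)
  then have "closed_projection B \<and> closed_projection (- B)"
  proof induction
    case (Basic U)
    then show ?case
      by (auto intro: open_imp_closed_projection closed_imp_closed_projection)
  next
    case (Union B)
    have "- (\<Union>i. B i) = (\<Inter>i. - B i)" by auto
    then show ?case using Union closed_projection_UN[of B] closed_projection_INT[of "\<lambda>i. - B i"]
      by metis
  qed (auto intro: closed_imp_closed_projection simp: Compl_eq_Diff_UNIV[symmetric])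
  then show ?thesis ..
qed

section \<open>From Borel images to images of closed sets\<close>

lemma not_tower_borel_image:
  fixes B :: "'b::polish_space set" and h :: "'b \<Rightarrow> nat set"
  assumes B: "B \<in> sets borel" and h: "\<And>n. {x \<in> B. n \<in> h x} \<in> sets borel"
  shows "\<not> tower (h ` B)"
proof
  assume tower: "tower (h ` B)"
  txt \<open>The intersection of the \<open>?G n\<close> is the graph of \<open>h\<close>, with sets as 0-1 sequences.\<close>
  let ?G = "\<lambda>n. {x \<in> B. n \<in> h x} \<times> {c :: nat \<Rightarrow> real. c n = 1} \<union>
    (B - {x \<in> B. n \<in> h x}) \<times> {c :: nat \<Rightarrow> real. c n = 0}"
  have coord: "closed {c :: nat \<Rightarrow> real. c n = v}" for n v
    by (rule closed_Collect_eq) simp_all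
  have "?G n \<in> sets (borel \<Otimes>\<^sub>M borel)" for n
    by (intro sets.Un pair_measureI sets.Diff B h borel_closed coord)
  then have "(\<Inter>n. ?G n) \<in> sets borel"
    unfolding borel_prod by (intro sets.countable_INT') auto
  then have "closed_projection (\<Inter>n. ?G n)" by (rule borel_imp_closed_projection)
  then obtain C :: "(('b \<times> (nat \<Rightarrow> real)) \<times> (nat \<Rightarrow> real)) set"
    where "closed C \<and> (\<forall>p. p \<in> (\<Inter>n. ?G n) \<longleftrightarrow> (\<exists>z. (p, z) \<in> C))"
    unfolding closed_projection_def ..
  then have C: "closed C" "\<And>p. p \<in> (\<Inter>n. ?G n) \<longleftrightarrow> (\<exists>z. (p, z) \<in> C)"
    by (rule conjunct1, elim conjE) (rule spec)
  \<comment> \<open>\<open>e\<close> reads the value off the 0-1 sequence stored in the point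
    instead of applying \<open>h\<close>. On \<open>C\<close>, membership and non-membership of
    \<open>n\<close> thus become the closed conditions that coordinate \<open>n\<close> is 1 or
    0.\<close>
  define e where "e q = {n. snd (fst q) n = (1::real)}" for q :: "('b \<times> (nat \<Rightarrow> real)) \<times> (nat \<Rightarrow> real)"
  have CG: "fst q \<in> ?G n" if "q \<in> C" for q n
    using C(2)[of "fst q"] that by (cases q) auto
  have cont: "continuous_on UNIV (\<lambda>q :: ('b \<times> (nat \<Rightarrow> real)) \<times> (nat \<Rightarrow> real). snd (fst q) n)" for n
    by (rule continuous_on_product_then_coordinatewise
        [OF continuous_on_snd[OF continuous_on_fst[OF continuous_on_id]]])
  have cl: "closed {q \<in> C. snd (fst q) n = v}" for n v
    using closed_Int[OF C(1) closed_Collect_eq[OF cont continuous_on_const]]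
    by (simp add: Int_def)
  have e_fst: "e q = h (fst (fst q)) \<and> fst (fst q) \<in> B" if "q \<in> C" for q
    using CG[OF that] unfolding e_def by (cases q) fastforce
  have "h ` B = e ` C"
  proof
    show "h ` B \<subseteq> e ` C"
    proof
      fix a assume "a \<in> h ` B"
      then obtain x where x: "x \<in> B" "a = h x" by blast
      then have "(x, \<lambda>n. of_bool (n \<in> h x)) \<in> (\<Inter>n. ?G n)" by auto
      then obtain z where z: "((x, \<lambda>n. of_bool (n \<in> h x)), z) \<in> C" using C(2) by blast
      show "a \<in> e ` C" using e_fst[OF z] z x by (metis fst_conv image_eqI)
    qed
  qed (use e_fst in auto)
  moreover have "{q \<in> C. n \<notin> e q} = {q \<in> C. snd (fst q) n = 0}" for n
  proof -
    have "n \<notin> e q \<longleftrightarrow> snd (fst q) n = 0" if "q \<in> C" for q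
      using CG[OF that, of n] unfolding e_def by (cases q) auto
    then show ?thesis by blast
  qed
  moreover have "{q \<in> C. n \<in> e q} = {q \<in> C. snd (fst q) n = 1}" for n
    by (simp add: e_def)
  ultimately have "closed_tower_image C e"
    using C(1) cl tower by (simp add: closed_tower_image_def)
  then show False by (rule closed_tower_image.contradiction)
qed

section \<open>Analytic sets and the Baire space\<close>

lemma open_mem_set: "open {a :: 'a set. n \<in> a}"
proof -
  have "open ((\<lambda>c :: 'a \<Rightarrow> bool. c n) -` {True})"
    by (intro open_vimage open_discrete continuous_on_product_coordinates)
  moreover have "{a. n \<in> a} = (\<lambda>a n. n \<in> a) -` ((\<lambda>c. c n) -` {True})" by auto
  ultimately show ?thesis unfolding open_set_def by blast
qed

text \<open>Composing with the continuous \<open>g\<close> makes every Borel image of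
  \<open>A\<close> a Borel image of the Borel set \<open>B\<close>, which is the case already
  settled.\<close>

theorem analytic_set_in_class_T:
  fixes A :: "'a::topological_space set"
  assumes "analytic_set TYPE('b::polish_space) A"
  shows "A \<in> \<T>"
proof -
  obtain B :: "'b set" and g where B: "B \<in> sets borel" and g: "continuous_on B g" and A: "A = g ` B"
    using assms by (auto simp: analytic_set_def)
  have "\<not> tower (f ` A)" if f: "borel_function A [\<nat>]\<^sup>\<infinity> f" for f
  proof -
    have "g \<in> restrict_space borel B \<rightarrow>\<^sub>M restrict_space borel A"
      using borel_measurable_continuous_on_restrict[OF g] A
      by (intro measurable_restrict_space2) (auto simp: space_restrict_space)
    moreover have "f \<in> restrict_space borel A \<rightarrow>\<^sub>M borel"
      using f unfolding borel_function_def by (simp add: measurable_restrict_space2_iff)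
    ultimately have "(\<lambda>x. f (g x)) \<in> restrict_space borel B \<rightarrow>\<^sub>M borel"
      by (rule measurable_compose)
    then have "(\<lambda>x. f (g x)) -` {a. n \<in> a} \<inter> space (restrict_space borel B)
        \<in> sets (restrict_space borel B)" for n
      by (rule measurable_sets) (simp add: open_mem_set)
    \<comment> \<open>Sets Borel relative to \<open>B\<close> are Borel in the whole space because
      \<open>B\<close> is.\<close>
    then have "{x \<in> B. n \<in> f (g x)} \<in> sets borel" for n
      using B by (simp add: sets_restrict_space_iff space_restrict_space vimage_def
        Int_def conj_commute)
    then show ?thesis
      using not_tower_borel_image[OF B, of "\<lambda>x. f (g x)"] by (simp add: A image_image)
  qed
  then show ?thesis by (auto simp: class_T_def borel_image_def)
qed

text \<open>Rounding down maps the closed set of natural-valued real sequences onto the Baire space,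
  continuously there because the naturals are discrete among the reals.\<close>

lemma analytic_set_Baire_space: "analytic_set TYPE(nat \<Rightarrow> real) (UNIV :: (nat \<Rightarrow> nat) set)"
proof -
  let ?B = "\<Inter>n. (\<lambda>x :: nat \<Rightarrow> real. x n) -` \<nat>"
  let ?g = "\<lambda>(x :: nat \<Rightarrow> real) n. nat \<lfloor>x n\<rfloor>"
  have "closed ?B"
    by (intro closed_INT ballI closed_vimage closed_Nats) simp
  then have "?B \<in> sets borel" by (rule borel_closed)
  moreover have disc: "continuous_on \<nat> (\<lambda>t::real. nat \<lfloor>t\<rfloor>)"
    unfolding continuous_on_def
  proof
    fix t :: real assume "t \<in> \<nat>"
    \<comment> \<open>Radius 1 suffices: no other natural is closer than 1 to
      \<open>t\<close>.\<close>
    have "eventually (\<lambda>s. nat \<lfloor>s\<rfloor> = nat \<lfloor>t\<rfloor>) (at t within \<nat>)"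
      unfolding eventually_at
      using \<open>t \<in> \<nat>\<close> by (intro exI[of _ 1]) (auto elim!: Nats_cases simp: dist_real_def)
    then show "((\<lambda>t. nat \<lfloor>t\<rfloor>) \<longlongrightarrow> nat \<lfloor>t\<rfloor>) (at t within \<nat>)"
      by (rule tendsto_eventually)
  qed
  have "continuous_on ?B ?g"
    by (intro continuous_on_coordinatewise_then_product continuous_on_compose2[OF disc]
        continuous_on_subset[OF continuous_on_product_coordinates]) auto
  moreover have "UNIV = ?g ` ?B"
  proof -
    have "y \<in> ?g ` ?B" for y
      by (rule image_eqI[of _ _ "\<lambda>n. real (y n)"]) simp_all
    then show ?thesis by blast
  qed
  ultimately show ?thesis unfolding analytic_set_def by (intro exI conjI)
qed

theorem theorem3p6:
  shows "(\<forall>A :: real set. analytic_set TYPE('b::polish_space) A \<longrightarrow> A \<in> \<T>) \<and>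
    (UNIV :: (nat \<Rightarrow> nat) set) \<in> \<T>"
  by (intro conjI allI impI analytic_set_in_class_T[OF analytic_set_Baire_space])
    (rule analytic_set_in_class_T)

end
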